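(* For any integers $r\ge 1$, $s\ge 0$ and $w\ge s+r+1$, we have $$S_w\begin{pmatrix}s\\ r\end{pmatrix}=\binom{w-1}{s}\,\zeta(w),$$ where $$S_w\begin{pmatrix}s\\ r\end{pmatrix}=\sum_{\substack{l_1,\ldots,l_s\ge 1,\ k_1,\ldots,k_r\ge 1,\ k_r\ge 2\\ l_1+\cdots+l_s+k_1+\cdots+k_r=w}}\ \ \sum_{0<a_1<\cdots<a_r\ge b_s\ge\cdots\ge b_1>0}\frac{1}{a_1^{k_1}\cdots a_r^{k_r}\,b_1^{l_1}\cdots b_s^{l_s}} .$$
   Context: Here $\zeta(w)=\sum_{m\ge1}m^{-w}$. The inner sum is over positive integers $a_1,\dots,a_r,b_1,\dots,b_s$ (no $b$'s when $s=0$). It is the Schur multiple zeta value of anti-hook shape with bottom row $l_1,\dots,l_s,k_r$ and rightmost column $k_1,\dots,k_r$ (top to bottom), so $S_w\begin{pmatrix}s\\ r\end{pmatrix}$ is the sum of Schur multiple zeta values over all admissible Young tableaux of this anti-hook shape and of weight $w$. *)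

theory Defs
  imports "HOL-Analysis.Analysis"
begin

definition zeta :: "nat \<Rightarrow> real" where
  "zeta w = (\<Sum>\<^sub>\<infinity>m\<in>{1..}. 1 / real m ^ w)"

text \<open>
  Tuples are lists read left to right, so \<open>x\<^sub>i\<close> is \<open>xs ! (i - 1)\<close>.  An index
  is a pair \<open>(ls, ks)\<close>: the bottom row of the anti-hook is \<open>ls @ [last ks]\<close>, its rightmost
  column, from top to bottom, is \<open>ks\<close>.
\<close>

definition admissible_indices :: "nat \<Rightarrow> nat \<Rightarrow> nat \<Rightarrow> (nat list \<times> nat list) set" where
  "admissible_indices s r w =
     {(ls, ks). length ls = s \<and> length ks = r \<and>
        (\<forall>l\<in>set ls. 1 \<le> l) \<and> (\<forall>k\<in>set ks. 1 \<le> k) \<and> 2 \<le> last ks \<and>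
        sum_list ls + sum_list ks = w}"

text \<open>
  The pairs \<open>(bs, as)\<close> with \<open>0 < a\<^sub>1 < \<dots> < a\<^sub>r \<ge> b\<^sub>s \<ge> \<dots> \<ge> b\<^sub>1 > 0\<close>.  The list
  \<open>bs @ [last as]\<close> is the bottom row; for \<open>s = 0\<close> its condition is void.
\<close>

definition antihook_fillings :: "nat \<Rightarrow> nat \<Rightarrow> (nat list \<times> nat list) set" where
  "antihook_fillings s r =
     {(bs, as). length bs = s \<and> length as = r \<and>
        sorted_wrt (<) (0 # as) \<and> sorted_wrt (\<le>) (bs @ [last as]) \<and> (\<forall>b\<in>set bs. 0 < b)}"

definition antihook_term :: "nat list \<Rightarrow> nat list \<Rightarrow> nat list \<times> nat list \<Rightarrow> real" where
  "antihook_term ls ks = (\<lambda>(bs, as).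
     1 / ((\<Prod>i<length ks. real (as ! i) ^ (ks ! i)) *
          (\<Prod>j<length ls. real (bs ! j) ^ (ls ! j))))"

definition schur_mzv_antihook :: "nat list \<Rightarrow> nat list \<Rightarrow> real" where
  "schur_mzv_antihook ls ks =
     (\<Sum>\<^sub>\<infinity>p\<in>antihook_fillings (length ls) (length ks). antihook_term ls ks p)"

definition S_antihook :: "nat \<Rightarrow> nat \<Rightarrow> nat \<Rightarrow> real" where
  "S_antihook w s r = (\<Sum>(ls, ks)\<in>admissible_indices s r w. schur_mzv_antihook ls ks)"

text \<open>The outer sum is over a finite set, so it is not the default value \<open>0\<close>.\<close>

lemma finite_admissible_indices: "finite (admissible_indices s r w)"
proof (rule finite_subset)
  show "admissible_indices s r w \<subseteq>
      {ls. set ls \<subseteq> {..w} \<and> length ls = s} \<times> {ks. set ks \<subseteq> {..w} \<and> length ks = r}"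
    by (auto simp: admissible_indices_def dest!: member_le_sum_list)
  show "finite ({ls. set ls \<subseteq> {..w} \<and> length ls = s} \<times> {ks. set ks \<subseteq> {..w} \<and> length ks = r})"
    by (intro finite_cartesian_product finite_lists_length_eq) auto
qed

end

theory Submission
  imports Defs
begin

text \<open>
  All products and sums over \<open>m\<close> start at \<open>m = 1\<close>.  Weight the value of an index by \<open>x ^ i * y ^ j * z ^ s\<close> with \<open>j = r - 1\<close> and
  \<open>i = w - r - s - 1\<close>, for small positive \<open>x\<close>, \<open>y\<close>, \<open>z\<close>.  For a fixed largest entry
  \<open>a\<^sub>r = a\<close>, geometric series turn the sum over all exponents and all other entries into
  \<open>1 / (a * (a - x)) * (\<Prod>m<a. 1 + y / (m - x)) * (\<Prod>m\<le>a. 1 / (1 - z / (m - x)))\<close>,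
  which depends on \<open>p = x + z\<close> and \<open>c = y + z\<close> only:
  it is \<open>1 / (a * (a - p)) * (\<Prod>m<a. 1 + c / (m - p))\<close>.  A connected sum
  gives \<open>\<Sum>m. 1 / ((m - p) * (m - c))\<close> for the sum over \<open>a\<close>, and the coefficients of this series are
  \<open>binomial (i + j + s + 1) s * zeta (i + j + s + 2)\<close>.
\<close>

section \<open>Iterated sums of nonnegative families\<close>

text \<open>Tonelli: for nonnegative terms, convergence of the iterated sums already gives
  summability of the whole family.\<close>

lemma has_sum_Sigma_nonneg:
  fixes f :: "'a \<times> 'b \<Rightarrow> real"
  assumes "\<And>x. x \<in> A \<Longrightarrow> ((\<lambda>y. f (x, y)) has_sum g x) (B x)" "(g has_sum S) A"
    and "\<And>x y. x \<in> A \<Longrightarrow> y \<in> B x \<Longrightarrow> 0 \<le> f (x, y)"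
  shows "(f has_sum S) (Sigma A B)"
  by (rule has_sum_SigmaI[OF assms(1,2) summable_on_SigmaI[OF assms(1) has_sum_imp_summable[OF assms(2)] assms(3)]])

lemma has_sum_times_nonneg:
  fixes f :: "'a \<Rightarrow> real" and g :: "'b \<Rightarrow> real"
  assumes f: "(f has_sum S) A" and g: "(g has_sum T) B"
    and "\<And>x. x \<in> A \<Longrightarrow> 0 \<le> f x" "\<And>y. y \<in> B \<Longrightarrow> 0 \<le> g y"
  shows "((\<lambda>(x, y). f x * g y) has_sum (S * T)) (A \<times> B)"
proof (rule has_sum_Sigma_nonneg)
  show "((\<lambda>y. (\<lambda>(x, y). f x * g y) (x, y)) has_sum (f x * T)) B" for x
    using has_sum_cmult_right[OF g] by simp
qed (use assms in \<open>auto intro: has_sum_cmult_left\<close>)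

section \<open>Telescoping Pochhammer ratios and the connected sum\<close>

text \<open>The ratio has order k^(c - M) with c - M \<le> -1/2. In the extreme case this is
  k^(-1/2), so the square is compared with 1 / (k + 2), which avoids roots in the induction.\<close>

lemma pochhammer_ratio_tendsto_0:
  fixes p c M :: real
  assumes "0 \<le> p" "p \<le> 1/2" "0 \<le> c" "c \<le> 1/2" "1 \<le> M"
  shows "(\<lambda>k. pochhammer (1 - p + c) k / pochhammer (1 + M - p) k) \<longlonglongrightarrow> 0"
proof -
  define E where "E k = pochhammer (1 - p + c) k / pochhammer (1 + M - p) k" for k
  define q where "q k = (1 - p + c + real k) / (1 + M - p + real k)" for k
  have E_Suc: "E (Suc k) = E k * q k" for k
    by (simp add: E_def q_def pochhammer_Suc)
  have bound: "(E k)\<^sup>2 * (real k + 2) \<le> 2" for k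
  proof (induction k)
    case 0
    then show ?case by (simp add: E_def)
  next
    case (Suc k)
    have q0: "0 \<le> q k" using assms by (simp add: q_def)
    \<comment> \<open>The bound is the value of \<open>q k\<close> at the extreme point p = 0, c =
      1/2, M = 1.\<close>
    have "q k \<le> (real k + 3/2) / (real k + 2)"
    proof -
      have "(1 - p + c + real k) * (real k + 2) \<le> (real k + 3/2) * (1 - p + 1 + real k)"
      proof -
        have "0 \<le> (1/2 - c) * (real k + 2) + p / 2" using assms by simp
        then show ?thesis by (simp add: algebra_simps add_divide_distrib)
      qed
      also have "\<dots> \<le> (real k + 3/2) * (1 + M - p + real k)"
        using assms by (intro mult_left_mono) auto
      finally show ?thesis using assms by (simp add: q_def divide_simps) (simp add: algebra_simps)
    qed
    then have "(q k)\<^sup>2 \<le> ((real k + 3/2) / (real k + 2))\<^sup>2"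
      using q0 by (rule power_mono)
    then have "(q k)\<^sup>2 * (real k + 3) \<le> ((real k + 3/2) / (real k + 2))\<^sup>2 * (real k + 3)"
      by (intro mult_right_mono) auto
    also have "\<dots> \<le> real k + 2"
    proof -
      \<comment> \<open>With t = k + 2 the left side is t^3 - 3 t / 4 + 1 / 4.\<close>
      have "(real k + 3/2)\<^sup>2 * (real k + 3) \<le> (real k + 2) * (real k + 2)\<^sup>2"
        by (simp add: power2_eq_square algebra_simps)
      then show ?thesis by (simp add: power_divide pos_divide_le_eq)
    qed
    finally have "(q k)\<^sup>2 * (real k + 3) \<le> real k + 2" .
    then have "(E k)\<^sup>2 * ((q k)\<^sup>2 * (real k + 3)) \<le> (E k)\<^sup>2 * (real k + 2)"
      by (intro mult_left_mono) auto
    also have "\<dots> \<le> 2" by (rule Suc)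
    finally show ?case by (simp add: E_Suc power_mult_distrib algebra_simps)
  qed
  have "(\<lambda>k. (E k)\<^sup>2) \<longlonglongrightarrow> 0"
  proof (rule tendsto_sandwich[of "\<lambda>_. 0"])
    show "\<forall>\<^sub>F k in sequentially. (E k)\<^sup>2 \<le> 2 / (real k + 2)"
      using bound by (simp add: pos_le_divide_eq)
    show "(\<lambda>k. 2 / (real k + 2)) \<longlonglongrightarrow> 0" by real_asymp
  qed auto
  then have "E \<longlonglongrightarrow> 0"
    by simp
  then show ?thesis by (simp add: E_def[abs_def])
qed

text \<open>Consecutive ratios \<open>E k\<close> and \<open>E (Suc k)\<close> differ by M - c times
  the summand, because (1 + M - p + k) - (1 - p + c + k) = M - c. The sum telescopes from
  \<open>E 0 = 1\<close> to the limit 0.\<close>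

lemma has_sum_pochhammer_ratio:
  fixes p c M :: real
  assumes "0 \<le> p" "p \<le> 1/2" "0 \<le> c" "c \<le> 1/2" "1 \<le> M"
  shows "((\<lambda>k. pochhammer (1 - p + c) k / pochhammer (1 + M - p) (Suc k)) has_sum 1 / (M - c)) UNIV"
proof (rule sums_nonneg_imp_has_sum)
  define E where "E k = pochhammer (1 - p + c) k / pochhammer (1 + M - p) k" for k
  have "(\<lambda>k. E k - E (Suc k)) sums (E 0 - 0)"
    using pochhammer_ratio_tendsto_0[OF assms] by (intro telescope_sums') (simp add: E_def)
  then have "(\<lambda>k. (E k - E (Suc k)) / (M - c)) sums (1 / (M - c))"
    using sums_divide[of _ "E 0"] by (force simp: E_def)
  moreover have "(E k - E (Suc k)) / (M - c)
      = pochhammer (1 - p + c) k / pochhammer (1 + M - p) (Suc k)" for k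
  proof -
    have "0 < pochhammer (1 + M - p) k" "0 < 1 + M - p + real k"
      using assms by (auto intro!: pochhammer_pos)
    moreover have "A / B - A * (D - u) / (B * D) = u * (A / (B * D))" if "0 < B" "0 < D" for A B D u :: real
      using that by (simp add: field_simps)
    ultimately have "E k - E (Suc k) = (M - c) * (pochhammer (1 - p + c) k / pochhammer (1 + M - p) (Suc k))"
      unfolding E_def pochhammer_Suc by (smt (verit))
    then show ?thesis using assms by simp
  qed
  ultimately show "(\<lambda>k. pochhammer (1 - p + c) k / pochhammer (1 + M - p) (Suc k)) sums (1 / (M - c))"
    by simp
  show "0 \<le> pochhammer (1 - p + c) k / pochhammer (1 + M - p) (Suc k)" for k
    using assms by (intro divide_nonneg_nonneg pochhammer_nonneg) auto
qed

text \<open>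
  With \<open>P k = (\<Prod>n=1..k. n - p)\<close>, the connector \<open>P a * P m / P (a + m)\<close> is symmetric in
  \<open>a\<close> and \<open>m\<close>.  The double sum of \<open>G\<close> below telescopes in either variable.
\<close>

lemma connected_sum_identity:
  fixes p c V :: real
  assumes "0 \<le> p" "p \<le> 1/2" "0 \<le> c" "c \<le> 1/2"
    and V: "((\<lambda>m. 1 / ((real (Suc m) - p) * (real (Suc m) - c))) has_sum V) UNIV"
  shows "((\<lambda>a. pochhammer (1 - p + c) a / pochhammer (1 - p) (Suc a) / real (Suc a)) has_sum V) UNIV"
proof -
  define P where "P k = pochhammer (1 - p) k" for k
  \<comment> \<open>Both indices start at 0: \<open>G (m, a)\<close> is the connector at a + 1 and m
    + 1, times \<open>pochhammer (1 - p + c) a / P (Suc a)\<close>, times 1 / (m + 1 - p).\<close>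
  define G where "G = (\<lambda>(m, a). pochhammer (1 - p + c) a * P m / P (Suc a + Suc m))"
  have Ppos: "0 < P k" for k
    using assms by (auto simp: P_def intro!: pochhammer_pos)
  \<comment> \<open>Splitting the denominator after \<open>Suc a\<close> factors leaves the
    denominator of the telescoping lemma with \<open>M = Suc a\<close>; exchanging \<open>a\<close>
    and \<open>m\<close> serves the other direction.\<close>
  have split: "P (Suc a + Suc m) = P (Suc a) * pochhammer (1 + real (Suc a) - p) (Suc m)" for a m
    using pochhammer_product'[of "1 - p" "Suc a" "Suc m"] by (simp add: P_def algebra_simps del: pochhammer_Suc)
  have Gnn: "0 \<le> G (m, a)" for m a
    using assms Ppos[of m] Ppos[of "Suc a + Suc m"]
    by (auto simp: G_def intro!: mult_nonneg_nonneg pochhammer_nonneg divide_nonneg_nonneg)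
  have sum_a: "((\<lambda>a. G (m, a)) has_sum 1 / ((real (Suc m) - p) * (real (Suc m) - c))) UNIV" for m
  proof -
    have "((\<lambda>a. P m / P (Suc m) * (pochhammer (1 - p + c) a / pochhammer (1 + real (Suc m) - p) (Suc a)))
        has_sum P m / P (Suc m) * (1 / (real (Suc m) - c))) UNIV"
      using assms by (intro has_sum_cmult_right has_sum_pochhammer_ratio) auto
    moreover have "P m / P (Suc m) * (1 / (real (Suc m) - c)) = 1 / ((real (Suc m) - p) * (real (Suc m) - c))"
    proof -
      have "P (Suc m) = P m * (real (Suc m) - p)" by (simp add: P_def pochhammer_Suc)
      then show ?thesis using Ppos[of m] by simp
    qed
    moreover have "P m / P (Suc m) * (pochhammer (1 - p + c) a / pochhammer (1 + real (Suc m) - p) (Suc a))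
        = G (m, a)" for a
      using split[of m a] by (simp add: G_def add.commute)
    ultimately show ?thesis by simp
  qed
  have sum_m: "((\<lambda>m. G (m, a)) has_sum pochhammer (1 - p + c) a / P (Suc a) / real (Suc a)) UNIV" for a
  proof -
    \<comment> \<open>With 0 in place of \<open>c\<close>, the numerator of the telescoping sum is
      \<open>P m\<close> and its value is 1 / (a + 1).\<close>
    have "((\<lambda>m. pochhammer (1 - p + c) a / P (Suc a) * (pochhammer (1 - p + 0) m / pochhammer (1 + real (Suc a) - p) (Suc m)))
        has_sum pochhammer (1 - p + c) a / P (Suc a) * (1 / (real (Suc a) - 0))) UNIV"
      using assms by (intro has_sum_cmult_right has_sum_pochhammer_ratio) auto
    moreover have "pochhammer (1 - p + c) a / P (Suc a) * (pochhammer (1 - p + 0) m / pochhammer (1 + real (Suc a) - p) (Suc m))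
        = G (m, a)" for m
      using split[of a m] by (simp add: G_def P_def)
    ultimately show ?thesis by simp
  qed
  have "(G has_sum V) (UNIV \<times> UNIV)"
    using sum_a V Gnn by (rule has_sum_Sigma_nonneg)
  then have "((\<lambda>(a, m). G (m, a)) has_sum V) (UNIV \<times> UNIV)"
    by (rule has_sum_swap[THEN iffD1])
  then show ?thesis
    by (rule has_sum_SigmaD) (use sum_m in \<open>simp add: P_def\<close>)
qed

section \<open>The zeta side of the generating function\<close>

text \<open>Newton's binomial series with exponent -(n + 1): upper negation produces a sign (-1)^s,
  which cancels the one in (-t)^s.\<close>

lemma has_sum_negative_binomial:
  fixes t :: real
  assumes "0 \<le> t" "t < 1"
  shows "((\<lambda>s. real ((s + n) choose s) * t ^ s) has_sum 1 / (1 - t) ^ Suc n) UNIV"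
proof (rule sums_nonneg_imp_has_sum)
  have "(\<lambda>s. ((- real (Suc n)) gchoose s) * (- t) ^ s) sums (1 + - t) powr (- real (Suc n))"
    using assms by (intro gen_binomial_real) auto
  moreover have "((- real (Suc n)) gchoose s) * (- t) ^ s = real ((s + n) choose s) * t ^ s" for s
  proof -
    have "real (Suc n) + real s - 1 = real (s + n)" by simp
    then have "((- real (Suc n)) gchoose s) = (- 1) ^ s * real ((s + n) choose s)"
      unfolding gbinomial_minus binomial_gbinomial by (simp only:)
    moreover have "(- t) ^ s = (- 1) ^ s * t ^ s" by (rule power_minus)
    ultimately show ?thesis by simp
  qed
  moreover have "(1 + - t) powr (- real (Suc n)) = 1 / (1 - t) ^ Suc n"
  proof -
    have "(1 - t) powr real (Suc n) = (1 - t) ^ Suc n" using assms by (intro powr_realpow) simp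
    then show ?thesis unfolding powr_minus by (simp add: inverse_eq_divide del: of_nat_Suc power_Suc)
  qed
  ultimately show "(\<lambda>s. real ((s + n) choose s) * t ^ s) sums (1 / (1 - t) ^ Suc n)"
    by simp
qed (use assms in auto)

lemma has_sum_geometric:
  fixes t :: real
  assumes "0 \<le> t" "t < 1"
  shows "((\<lambda>n. t ^ n) has_sum 1 / (1 - t)) UNIV"
  using assms by (intro sums_nonneg_imp_has_sum geometric_sums) auto

text \<open>For 2 \<le> w the series converges, so \<open>zeta w\<close> is a genuine sum and not
  the default value 0 of \<open>infsum\<close>.\<close>

lemma has_sum_zeta:
  assumes "2 \<le> w"
  shows "((\<lambda>m. 1 / real (Suc m) ^ w) has_sum zeta w) UNIV"
proof -
  have "summable (\<lambda>m. 1 / real (Suc m) ^ w)"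
    using inverse_power_summable[OF assms, where 'a = real]
    by (subst summable_Suc_iff) (simp add: inverse_eq_divide)
  then have "(\<lambda>m. 1 / real (Suc m) ^ w) summable_on UNIV"
    by (rule summable_nonneg_imp_summable_on) auto
  moreover have "infsum (\<lambda>m. 1 / real m ^ w) {1..} = infsum (\<lambda>m. 1 / real (Suc m) ^ w) UNIV"
    by (rule infsum_reindex_bij_witness[where i = Suc and j = "\<lambda>m. m - 1"]) auto
  ultimately show ?thesis
    by (simp add: zeta_def has_sum_iff)
qed

text \<open>The sum over s is a negative binomial series in z / n with value x^i y^j / (n - z)^(i +
  j + 2). The sums over i and j are then geometric, with ratios x / (n - z) and y / (n - z), at most
  1/3.\<close>

lemma has_sum_coefficients:
  fixes x y z :: real and n :: nat
  assumes "0 < x" "x \<le> 1/4" "0 < y" "y \<le> 1/4" "0 < z" "z \<le> 1/4" "1 \<le> n"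
  shows "((\<lambda>(i, j, s). real ((i + j + s + 1) choose s) / real n ^ (i + j + s + 2) * x ^ i * y ^ j * z ^ s)
    has_sum 1 / ((real n - (x + z)) * (real n - (y + z)))) UNIV"
proof -
  define N where "N = real n"
  have N: "1 \<le> N" using assms by (simp add: N_def)
  have s: "((\<lambda>s. real ((i + j + s + 1) choose s) / N ^ (i + j + s + 2) * x ^ i * y ^ j * z ^ s)
      has_sum 1 / (N - z)\<^sup>2 * ((x / (N - z)) ^ i * (y / (N - z)) ^ j)) UNIV" for i j
  proof -
    have "((\<lambda>s. x ^ i * y ^ j / N ^ (i + j + 2) * (real ((s + (i + j + 1)) choose s) * (z / N) ^ s))
      has_sum x ^ i * y ^ j / N ^ (i + j + 2) * (1 / (1 - z / N) ^ Suc (i + j + 1))) UNIV"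
      using N assms by (intro has_sum_cmult_right has_sum_negative_binomial) auto
    moreover have "x ^ i * y ^ j / N ^ (i + j + 2) * (1 / (1 - z / N) ^ Suc (i + j + 1))
        = 1 / (N - z)\<^sup>2 * ((x / (N - z)) ^ i * (y / (N - z)) ^ j)"
    proof -
      have "N ^ (i + j + 2) * (1 - z / N) ^ Suc (i + j + 1) = (N * (1 - z / N)) ^ (i + j + 2)"
        by (simp add: power_mult_distrib)
      also have "N * (1 - z / N) = N - z" using N by (simp add: field_simps)
      finally show ?thesis by (simp add: power_add power_divide power2_eq_square)
    qed
    moreover have "x ^ i * y ^ j / N ^ (i + j + 2) * (real ((s + (i + j + 1)) choose s) * (z / N) ^ s)
        = real ((i + j + s + 1) choose s) / N ^ (i + j + s + 2) * x ^ i * y ^ j * z ^ s" for s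
      by (simp add: power_add power_divide ac_simps)
    ultimately show ?thesis by simp
  qed
  have geo: "((\<lambda>(i, j). (x / (N - z)) ^ i * (y / (N - z)) ^ j)
      has_sum 1 / (1 - x / (N - z)) * (1 / (1 - y / (N - z)))) (UNIV \<times> UNIV)"
    using N assms by (intro has_sum_times_nonneg has_sum_geometric) auto
  have "((\<lambda>ij. 1 / (N - z)\<^sup>2 * (case ij of (i, j) \<Rightarrow> (x / (N - z)) ^ i * (y / (N - z)) ^ j))
      has_sum 1 / (N - z)\<^sup>2 * (1 / (1 - x / (N - z)) * (1 / (1 - y / (N - z))))) (UNIV \<times> UNIV)"
    by (rule has_sum_cmult_right[OF geo])
  moreover have "1 / (N - z)\<^sup>2 * (1 / (1 - x / (N - z)) * (1 / (1 - y / (N - z))))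
      = 1 / ((N - (x + z)) * (N - (y + z)))"
  proof -
    have "(N - z) * (1 - x / (N - z)) = N - (x + z)" "(N - z) * (1 - y / (N - z)) = N - (y + z)"
      using N assms by (simp_all add: field_simps)
    then have "(N - z)\<^sup>2 * ((1 - x / (N - z)) * (1 - y / (N - z))) = (N - (x + z)) * (N - (y + z))"
      by (metis (no_types, lifting) mult.assoc mult.left_commute power2_eq_square)
    then show ?thesis by (metis divide_divide_eq_left mult.right_neutral times_divide_eq_right mult_1 times_divide_times_eq)
  qed
  ultimately have ij: "((\<lambda>ij. 1 / (N - z)\<^sup>2 * (case ij of (i, j) \<Rightarrow> (x / (N - z)) ^ i * (y / (N - z)) ^ j))
      has_sum 1 / ((N - (x + z)) * (N - (y + z)))) (UNIV \<times> UNIV)"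
    by simp
  have "((\<lambda>((i, j), s). real ((i + j + s + 1) choose s) / N ^ (i + j + s + 2) * x ^ i * y ^ j * z ^ s)
      has_sum 1 / ((N - (x + z)) * (N - (y + z)))) ((UNIV \<times> UNIV) \<times> UNIV)"
    by (rule has_sum_Sigma_nonneg[OF _ ij]) (use s assms N in auto)
  also have "?this \<longleftrightarrow> ?thesis"
    unfolding N_def
    by (rule has_sum_reindex_bij_witness[where i = "\<lambda>(i, j, s). ((i, j), s)" and j = "\<lambda>((i, j), s). (i, j, s)"]) auto
  finally show ?thesis .
qed

text \<open>Each term of the series over m is expanded in powers of x, y, z and the order of
  summation exchanged; for fixed (i, j, s) the sum over m is a zeta value.\<close>

lemma has_sum_zeta_generating_function:
  fixes x y z :: real
  assumes "0 < x" "x \<le> 1/4" "0 < y" "y \<le> 1/4" "0 < z" "z \<le> 1/4"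
  defines "V \<equiv> (\<Sum>\<^sub>\<infinity>m. 1 / ((real (Suc m) - (x + z)) * (real (Suc m) - (y + z))))"
  shows "((\<lambda>m. 1 / ((real (Suc m) - (x + z)) * (real (Suc m) - (y + z)))) has_sum V) UNIV"
    and "((\<lambda>(i, j, s). real ((i + j + s + 1) choose s) * zeta (i + j + s + 2) * (x ^ i * y ^ j * z ^ s)) has_sum V) UNIV"
proof -
  let ?v = "\<lambda>m. 1 / ((real (Suc m) - (x + z)) * (real (Suc m) - (y + z)))"
  define F where "F = (\<lambda>(m, (i, j, s)). real ((i + j + s + 1) choose s) / real (Suc m) ^ (i + j + s + 2) * x ^ i * y ^ j * z ^ s)"
  have "?v summable_on UNIV"
  proof (rule summable_on_comparison_test)
    \<comment> \<open>Since x + z and y + z are at most 1/2, each factor of the denominator is at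
      least (m + 1) / 2.\<close>
    show "(\<lambda>m. 4 * (1 / real (Suc m) ^ 2)) summable_on UNIV"
      using has_sum_zeta[of 2] by (intro summable_on_cmult_right) (auto simp: has_sum_iff)
    have half: "real (Suc m) / 2 \<le> real (Suc m) - (x + z)" "real (Suc m) / 2 \<le> real (Suc m) - (y + z)" for m
      using assms by auto
    show "?v m \<le> 4 * (1 / real (Suc m) ^ 2)" for m
    proof -
      have "(real (Suc m) / 2) * (real (Suc m) / 2) \<le> (real (Suc m) - (x + z)) * (real (Suc m) - (y + z))"
        using half[of m] by (intro mult_mono) auto
      then have "?v m \<le> 1 / ((real (Suc m) / 2) * (real (Suc m) / 2))"
        by (intro divide_left_mono) (use half[of m] in \<open>auto intro!: mult_pos_pos\<close>)
      also have "\<dots> = 4 * (1 / real (Suc m) ^ 2)" by (simp add: power2_eq_square)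
      finally show ?thesis .
    qed
    show "0 \<le> ?v m" for m
      using half[of m] by (auto intro!: divide_nonneg_nonneg mult_nonneg_nonneg simp del: of_nat_Suc)
  qed
  then show V: "(?v has_sum V) UNIV" unfolding V_def by simp
  have "(F has_sum V) (UNIV \<times> UNIV)"
  proof (rule has_sum_Sigma_nonneg[OF _ V])
    show "((\<lambda>u. F (m, u)) has_sum ?v m) UNIV" for m
      using has_sum_coefficients[OF assms(1-6), of "Suc m"] by (simp add: F_def)
    show "0 \<le> F (m, u)" for m u
      using assms by (cases u) (auto simp: F_def)
  qed
  then have "((\<lambda>(u, m). F (m, u)) has_sum V) (UNIV \<times> UNIV)"
    by (rule has_sum_swap[THEN iffD1])
  moreover have "((\<lambda>m. F (m, u)) has_sum (case u of (i, j, s) \<Rightarrow>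
      real ((i + j + s + 1) choose s) * zeta (i + j + s + 2) * (x ^ i * y ^ j * z ^ s))) UNIV" for u
  proof (cases u)
    case (fields i j s)
    have "((\<lambda>m. real ((i + j + s + 1) choose s) * (1 / real (Suc m) ^ (i + j + s + 2)) * (x ^ i * y ^ j * z ^ s))
      has_sum real ((i + j + s + 1) choose s) * zeta (i + j + s + 2) * (x ^ i * y ^ j * z ^ s)) UNIV"
      by (intro has_sum_cmult_left has_sum_cmult_right has_sum_zeta) auto
    then show ?thesis by (simp add: fields F_def mult.assoc)
  qed
  ultimately show "((\<lambda>(i, j, s). real ((i + j + s + 1) choose s) * zeta (i + j + s + 2) * (x ^ i * y ^ j * z ^ s)) has_sum V) UNIV"
    by - (rule has_sum_SigmaD, assumption, simp)
qed

section \<open>Uniqueness of power series coefficients\<close>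

text \<open>Small positive arguments suffice: once the coefficients below n cancel, dividing by x^n
  leaves a difference series that vanishes on (0, e], and its constant term is the limit at 0 from
  the right.\<close>

lemma powser_coeff_unique:
  fixes f g :: "nat \<Rightarrow> real" and e :: real
  assumes e: "0 < e"
    and fg: "\<And>x. 0 < x \<Longrightarrow> x \<le> e \<Longrightarrow> \<exists>V. (\<lambda>n. f n * x ^ n) sums V \<and> (\<lambda>n. g n * x ^ n) sums V"
  shows "f n = g n"
proof (induction n rule: less_induct)
  case (less n)
  define h where "h k = f (k + n) - g (k + n)" for k
  have h: "(\<lambda>k. h k * x ^ k) sums 0" if x: "0 < x" "x \<le> e" for x
  proof -
    from fg[OF x] obtain V where V: "(\<lambda>k. f k * x ^ k) sums V" "(\<lambda>k. g k * x ^ k) sums V"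
      by (elim exE conjE)
    have "(\<lambda>k. (f k - g k) * x ^ k) sums 0"
      using sums_diff[OF V] by (simp add: left_diff_distrib)
    moreover have "(\<Sum>k<n. (f k - g k) * x ^ k) = 0"
      using less by simp
    ultimately have "(\<lambda>k. (f (k + n) - g (k + n)) * x ^ (k + n)) sums 0"
      using sums_iff_shift[of "\<lambda>k. (f k - g k) * x ^ k" n 0] by simp
    then have "(\<lambda>k. h k * x ^ k * x ^ n / x ^ n) sums (0 / x ^ n)"
      by (intro sums_divide) (simp add: h_def power_add mult.assoc)
    then show ?thesis using x by simp
  qed
  define H where "H x = (\<Sum>k. h k * x ^ k)" for x
  have "(H \<longlongrightarrow> h 0) (at 0)"
  proof (rule powser_limit_0[OF e])
    \<comment> \<open>Convergence at \<open>e\<close> yields convergence for all |x| < e, negative x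
      included, as the limit theorem requires.\<close>
    show "(\<lambda>k. h k * x ^ k) sums H x" if "norm x < e" for x
      unfolding H_def using powser_inside[OF sums_summable[OF h[OF e order_refl]]] that e
      by (intro summable_sums) simp
  qed
  then have "(H \<longlongrightarrow> h 0) (at_right 0)"
    by (rule tendsto_within_subset) simp
  moreover have "\<forall>\<^sub>F x in at_right 0. H x = 0"
    by (rule eventually_at_rightI[OF _ e]) (use h in \<open>simp add: H_def sums_iff\<close>)
  then have "(H \<longlongrightarrow> 0) (at_right 0)"
    by (rule tendsto_eventually)
  ultimately have "h 0 = 0"
    by (intro tendsto_unique) auto
  then show ?case by (simp add: h_def)
qed

text \<open>Grouping by the exponent of x makes the fibre sums the coefficients of a power series.
  The conclusion keeps \<open>has_sum\<close> for each fibre, so the lemma can be iterated to remove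
  one variable at a time.\<close>

lemma powser_fibre_unique:
  fixes f g :: "nat \<times> 'b \<Rightarrow> real" and e :: real
  assumes e: "0 < e"
    and fg: "\<And>x. 0 < x \<Longrightarrow> x \<le> e \<Longrightarrow>
      \<exists>V. ((\<lambda>(n, b). f (n, b) * x ^ n) has_sum V) UNIV \<and> ((\<lambda>(n, b). g (n, b) * x ^ n) has_sum V) UNIV"
  shows "\<exists>W. ((\<lambda>b. f (n, b)) has_sum W) UNIV \<and> ((\<lambda>b. g (n, b)) has_sum W) UNIV"
proof -
  have fibre: "((\<lambda>b. u (n, b)) has_sum infsum (\<lambda>b. u (n, b)) UNIV) UNIV"
    and total: "(\<lambda>n. infsum (\<lambda>b. u (n, b)) UNIV * x ^ n) sums V"
    if u: "((\<lambda>(n, b). u (n, b) * x ^ n) has_sum V) UNIV" and x: "0 < x"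
    for u :: "nat \<times> 'b \<Rightarrow> real" and x V n
  proof -
    have UV: "((\<lambda>(n, b). u (n, b) * x ^ n) has_sum V) (UNIV \<times> UNIV)"
      using u by simp
    have "(\<lambda>b. u (n, b) * x ^ n) summable_on UNIV" for n
      using summable_on_SigmaD1[OF has_sum_imp_summable[OF UV]] by simp
    \<comment> \<open>The fibre is summable with the factor x^n, which is nonzero and can be divided
      out.\<close>
    then have *: "((\<lambda>b. u (n, b)) has_sum infsum (\<lambda>b. u (n, b)) UNIV) UNIV" for n
      using summable_on_cmult_left'[of "x ^ n" "\<lambda>b. u (n, b)"] x by (intro has_sum_infsum) auto
    then show "((\<lambda>b. u (n, b)) has_sum infsum (\<lambda>b. u (n, b)) UNIV) UNIV" .
    have "((\<lambda>n. infsum (\<lambda>b. u (n, b)) UNIV * x ^ n) has_sum V) UNIV"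
      by (rule has_sum_SigmaD[OF UV]) (simp only: prod.case has_sum_cmult_left[OF *])
    then show "(\<lambda>n. infsum (\<lambda>b. u (n, b)) UNIV * x ^ n) sums V"
      by (rule has_sum_imp_sums)
  qed
  have "infsum (\<lambda>b. f (n, b)) UNIV = infsum (\<lambda>b. g (n, b)) UNIV"
  proof (rule powser_coeff_unique[OF e])
    fix x :: real
    assume x: "0 < x" "x \<le> e"
    from fg[OF x] obtain V where
      V: "((\<lambda>(n, b). f (n, b) * x ^ n) has_sum V) UNIV" "((\<lambda>(n, b). g (n, b) * x ^ n) has_sum V) UNIV"
      by (elim exE conjE)
    show "\<exists>V. (\<lambda>n. infsum (\<lambda>b. f (n, b)) UNIV * x ^ n) sums V \<and> (\<lambda>n. infsum (\<lambda>b. g (n, b)) UNIV * x ^ n) sums V"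
      using total[OF V(1) x(1)] total[OF V(2) x(1)] by (intro exI conjI)
  qed
  moreover from fg[OF e order_refl] obtain V where
    V: "((\<lambda>(n, b). f (n, b) * e ^ n) has_sum V) UNIV" "((\<lambda>(n, b). g (n, b) * e ^ n) has_sum V) UNIV"
    by (elim exE conjE)
  ultimately show ?thesis using fibre[OF V(1) e, of n] fibre[OF V(2) e, of n] by (intro exI) simp
qed

section \<open>Sums over increasing lists\<close>

text \<open>A product of series, one per entry, expands into a sum over all choices of one exponent
  per entry.\<close>

lemma has_sum_prod_list_map2:
  fixes f :: "'a \<Rightarrow> 'b \<Rightarrow> real"
  assumes "\<And>a. a \<in> set as \<Longrightarrow> (f a has_sum g a) UNIV"
    and "\<And>a e. a \<in> set as \<Longrightarrow> 0 \<le> f a e"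
  shows "((\<lambda>es. prod_list (map2 f as es)) has_sum prod_list (map g as)) {es. length es = length as}"
  using assms
proof (induction as)
  case Nil
  then show ?case by (simp add: has_sum_finite_iff)
next
  case (Cons a as)
  have nonneg: "0 \<le> prod_list (map2 f as es)" for es
    using Cons.prems(2) by (intro prod_list_nonneg) (auto dest: set_zip_leftD)
  have "((\<lambda>(e, es). f a e * prod_list (map2 f as es)) has_sum g a * prod_list (map g as))
      (UNIV \<times> {es. length es = length as})"
    using Cons nonneg by (intro has_sum_times_nonneg) auto
  also have "?this \<longleftrightarrow> ((\<lambda>es. prod_list (map2 f (a # as) es)) has_sum prod_list (map g (a # as)))
      {es. length es = length (a # as)}"
    by (rule has_sum_reindex_bij_witness[where i = "\<lambda>es. (hd es, tl es)" and j = "\<lambda>(e, es). e # es"])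
      (auto simp: length_Suc_conv)
  finally show ?case .
qed

text \<open>These lists hold the column entries above the corner, and the weak ones below hold the
  row entries beside it. Their lengths are left free, to be recorded by the powers of y and
  z.\<close>

definition strict_lists :: "nat \<Rightarrow> nat list set" where
  "strict_lists n = {as. sorted_wrt (<) as \<and> set as \<subseteq> {1..n}}"

definition weak_lists :: "nat \<Rightarrow> nat list set" where
  "weak_lists n = {bs. sorted bs \<and> set bs \<subseteq> {1..n}}"

lemma strict_lists_Suc: "strict_lists (Suc n) = strict_lists n \<union> (\<lambda>as. as @ [Suc n]) ` strict_lists n"
proof (intro equalityI subsetI)
  fix as assume as: "as \<in> strict_lists (Suc n)"
  show "as \<in> strict_lists n \<union> (\<lambda>as. as @ [Suc n]) ` strict_lists n"
  proof (cases "Suc n \<in> set as")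
    case False
    then show ?thesis using as by (auto simp: strict_lists_def le_Suc_eq subset_iff)
  next
    case True
    then have "as \<noteq> []" by auto
    then obtain cs c where cs: "as = cs @ [c]" by (metis append_butlast_last_id)
    have "c = Suc n"
      using as True by (auto simp: strict_lists_def cs sorted_wrt_append)
    moreover have "cs \<in> strict_lists n"
      using as by (fastforce simp: strict_lists_def cs sorted_wrt_append \<open>c = Suc n\<close>)
    ultimately show ?thesis by (auto simp: cs)
  qed
qed (auto simp: strict_lists_def sorted_wrt_append subset_iff less_Suc_eq_le)

text \<open>Each i is either absent or present once; this is the generating function of the
  elementary symmetric polynomials.\<close>

lemma has_sum_strict_lists:
  fixes g :: "nat \<Rightarrow> real"
  shows "((\<lambda>as. prod_list (map g as)) has_sum (\<Prod>i=1..n. 1 + g i)) (strict_lists n)"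
proof (induction n)
  case 0
  have "strict_lists 0 = {[]}" by (auto simp: strict_lists_def)
  then show ?case by (simp add: has_sum_finite_iff)
next
  case (Suc n)
  have "((\<lambda>as. prod_list (map g (as @ [Suc n]))) has_sum (\<Prod>i=1..n. 1 + g i) * g (Suc n)) (strict_lists n)"
    using has_sum_cmult_left[OF Suc] by simp
  then have "((\<lambda>as. prod_list (map g as)) has_sum (\<Prod>i=1..n. 1 + g i) * g (Suc n))
      ((\<lambda>as. as @ [Suc n]) ` strict_lists n)"
    by (subst has_sum_reindex) (auto simp: inj_on_def o_def)
  with Suc have "((\<lambda>as. prod_list (map g as)) has_sum (\<Prod>i=1..n. 1 + g i) + (\<Prod>i=1..n. 1 + g i) * g (Suc n))
      (strict_lists (Suc n))"
    unfolding strict_lists_Suc by (rule has_sum_Un_disjoint) (auto simp: strict_lists_def)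
  then show ?case by (simp add: algebra_simps)
qed

text \<open>A sorted list with entries at most n + 1 ends in a block of k \<ge> 0 copies of n + 1,
  which \<open>takeWhile\<close> and \<open>dropWhile\<close> split off.\<close>

lemma weak_lists_Suc:
  "bij_betw (\<lambda>(bs, k). bs @ replicate k (Suc n)) (weak_lists n \<times> UNIV) (weak_lists (Suc n))"
proof (rule bij_betwI)
  let ?P = "\<lambda>b. b \<le> n"
  show "(\<lambda>bs. (takeWhile ?P bs, length (dropWhile ?P bs))) \<in> weak_lists (Suc n) \<rightarrow> weak_lists n \<times> UNIV"
    by (auto simp: weak_lists_def sorted_takeWhile dest!: set_takeWhileD)
  show "(\<lambda>(bs, k). bs @ replicate k (Suc n)) \<in> weak_lists n \<times> UNIV \<rightarrow> weak_lists (Suc n)"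
    by (fastforce simp: weak_lists_def sorted_append)
  show "(case (takeWhile ?P bs, length (dropWhile ?P bs)) of (bs, k) \<Rightarrow> bs @ replicate k (Suc n)) = bs"
    if "bs \<in> weak_lists (Suc n)" for bs
  proof -
    have mem: "set bs \<subseteq> {1..Suc n}" using that by (simp add: weak_lists_def)
    have s: "sorted (dropWhile ?P bs)" using that by (simp add: weak_lists_def sorted_dropWhile)
    have "b = Suc n" if b: "b \<in> set (dropWhile ?P bs)" for b
    proof (cases "dropWhile ?P bs")
      case (Cons c cs)
      have "\<not> ?P c" using Cons by (metis hd_dropWhile list.distinct(1) list.sel(1))
      moreover have "c \<le> b" using s b by (auto simp: Cons)
      moreover have "b \<le> Suc n" using b mem by (auto dest!: set_dropWhileD)
      ultimately show ?thesis by simp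
    qed (use b in \<open>simp only: list.set empty_iff\<close>)
    then have "replicate (length (dropWhile ?P bs)) (Suc n) = dropWhile ?P bs"
      by (intro replicate_length_same) auto
    then show ?thesis by simp
  qed
  show "(takeWhile ?P (case u of (bs, k) \<Rightarrow> bs @ replicate k (Suc n)),
      length (dropWhile ?P (case u of (bs, k) \<Rightarrow> bs @ replicate k (Suc n)))) = u"
    if "u \<in> weak_lists n \<times> UNIV" for u
  proof (cases u)
    case (Pair bs k)
    have "\<forall>b\<in>set bs. ?P b" using that Pair by (auto simp: weak_lists_def)
    moreover have "takeWhile ?P (replicate k (Suc n)) = []" "dropWhile ?P (replicate k (Suc n)) = replicate k (Suc n)"
      by (cases k; simp)+
    ultimately show ?thesis by (simp add: Pair takeWhile_append2 dropWhile_append2)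
  qed
qed

text \<open>Each i may occur any number of times and contributes a geometric series, as for complete
  homogeneous symmetric polynomials.\<close>

lemma has_sum_weak_lists:
  fixes g :: "nat \<Rightarrow> real"
  assumes "\<And>i. 1 \<le> i \<Longrightarrow> i \<le> n \<Longrightarrow> 0 \<le> g i \<and> g i < 1"
  shows "((\<lambda>bs. prod_list (map g bs)) has_sum (\<Prod>i=1..n. 1 / (1 - g i))) (weak_lists n)"
  using assms
proof (induction n)
  case 0
  have "weak_lists 0 = {[]}" by (auto simp: weak_lists_def)
  then show ?case by (simp add: has_sum_finite_iff)
next
  case (Suc n)
  have "((\<lambda>(bs, k). prod_list (map g bs) * g (Suc n) ^ k) has_sum
      (\<Prod>i=1..n. 1 / (1 - g i)) * (1 / (1 - g (Suc n)))) (weak_lists n \<times> UNIV)"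
  proof (rule has_sum_times_nonneg)
    show "0 \<le> prod_list (map g bs)" if "bs \<in> weak_lists n" for bs
      using that Suc.prems by (intro prod_list_nonneg) (auto simp: weak_lists_def)
  qed (use Suc in \<open>auto intro!: has_sum_geometric\<close>)
  moreover have "(\<lambda>(bs, k). prod_list (map g bs) * g (Suc n) ^ k)
      = (\<lambda>u. prod_list (map g (case u of (bs, k) \<Rightarrow> bs @ replicate k (Suc n))))"
    by auto
  ultimately have "((\<lambda>bs. prod_list (map g bs)) has_sum
      (\<Prod>i=1..n. 1 / (1 - g i)) * (1 / (1 - g (Suc n)))) (weak_lists (Suc n))"
    using has_sum_reindex_bij_betw[OF weak_lists_Suc[of n], of "\<lambda>bs. prod_list (map g bs)"] by simp
  then show ?case by simp
qed

section \<open>Weighted lists with free exponents\<close>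

text \<open>An entry \<open>a\<close> carries the exponent \<open>Suc e\<close>: \<open>t\<close>
  counts entries and \<open>x\<close> counts the excess of the exponent over 1.\<close>

definition weight :: "real \<Rightarrow> real \<Rightarrow> nat \<Rightarrow> nat \<Rightarrow> real" where
  "weight t x a e = t * x ^ e / real a ^ Suc e"

lemma weight_nonneg: "0 \<le> t \<Longrightarrow> 0 \<le> x \<Longrightarrow> 0 \<le> weight t x a e"
  by (simp add: weight_def)

lemma has_sum_weight:
  assumes "0 \<le> x" "x < real a"
  shows "(weight t x a has_sum t / (real a - x)) UNIV"
proof -
  have "((\<lambda>e. t / real a * (x / real a) ^ e) has_sum t / real a * (1 / (1 - x / real a))) UNIV"
    using assms by (intro has_sum_cmult_right has_sum_geometric) auto
  moreover have "t / real a * (1 / (1 - x / real a)) = t / (real a - x)"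
    using assms by (simp add: field_simps)
  moreover have "t / real a * (x / real a) ^ e = weight t x a e" for e
    by (simp add: weight_def power_divide)
  ultimately show ?thesis by (simp only:)
qed

lemma prod_list_weight:
  assumes "length as = length es"
  shows "prod_list (map2 (weight t x) as es)
    = t ^ length as * x ^ sum_list es / (\<Prod>i<length es. real (as ! i) ^ (map Suc es ! i))"
  using assms
proof (induction as es rule: list_induct2)
  case (Cons a as e es)
  then show ?case
    by (simp add: prod.lessThan_Suc_shift weight_def power_add del: prod.lessThan_Suc)
qed simp

definition strict_pairs :: "nat \<Rightarrow> (nat list \<times> nat list) set" where
  "strict_pairs n = (SIGMA as:strict_lists n. {fs. length fs = length as})"

definition weak_pairs :: "nat \<Rightarrow> (nat list \<times> nat list) set" where
  "weak_pairs n = (SIGMA bs:weak_lists n. {es. length es = length bs})"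

abbreviation list_weight :: "real \<Rightarrow> real \<Rightarrow> nat list \<times> nat list \<Rightarrow> real" where
  "list_weight t x \<equiv> \<lambda>(as, es). prod_list (map2 (weight t x) as es)"

lemma list_weight_nonneg: "0 \<le> t \<Longrightarrow> 0 \<le> x \<Longrightarrow> 0 \<le> list_weight t x u"
  by (cases u) (auto intro!: prod_list_nonneg weight_nonneg)

text \<open>Summing over the exponents first replaces each entry i by y / (i - x); the sum over
  lists is then a finite product.\<close>

lemma has_sum_strict_pairs:
  assumes "0 \<le> x" "x < 1" "0 \<le> y"
  shows "(list_weight y x has_sum (\<Prod>i=1..n. 1 + y / (real i - x))) (strict_pairs n)"
  unfolding strict_pairs_def
proof (rule has_sum_Sigma_nonneg[OF _ has_sum_strict_lists])
  show "((\<lambda>fs. list_weight y x (as, fs)) has_sum prod_list (map (\<lambda>i. y / (real i - x)) as))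
      {fs. length fs = length as}" if "as \<in> strict_lists n" for as
    using that assms
    by (auto simp: strict_lists_def intro!: has_sum_prod_list_map2 has_sum_weight weight_nonneg)
qed (use assms list_weight_nonneg in blast)

lemma has_sum_weak_pairs:
  assumes "0 \<le> x" "0 \<le> z" "x + z < 1"
  shows "(list_weight z x has_sum (\<Prod>i=1..n. 1 / (1 - z / (real i - x)))) (weak_pairs n)"
  unfolding weak_pairs_def
proof (rule has_sum_Sigma_nonneg[OF _ has_sum_weak_lists])
  show "((\<lambda>es. list_weight z x (bs, es)) has_sum prod_list (map (\<lambda>i. z / (real i - x)) bs))
      {es. length es = length bs}" if "bs \<in> weak_lists n" for bs
    using that assms
    by (auto simp: weak_lists_def intro!: has_sum_prod_list_map2 has_sum_weight weight_nonneg)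
  \<comment> \<open>The assumption x + z < 1 makes the ratio less than 1 already at i = 1.\<close>
  show "0 \<le> z / (real i - x) \<and> z / (real i - x) < 1" if "1 \<le> i" for i
    using that assms by (simp add: divide_simps)
qed (use assms list_weight_nonneg in blast)

text \<open>With p = x + z and c = y + z, the two factors at i combine to (i - p + c) / (i - p). The
  second product has one more factor, since row entries may equal the corner n + 1; together with 1
  / (n + 1 - x) it gives 1 / (n + 1 - p).\<close>

lemma prod_eq_pochhammer_ratio:
  fixes x y z :: real
  assumes "0 \<le> x" "0 \<le> z" "x + z < 1"
  shows "(\<Prod>i=1..n. 1 + y / (real i - x)) * (\<Prod>i=1..Suc n. 1 / (1 - z / (real i - x))) / (real (Suc n) * (real (Suc n) - x))
    = pochhammer (1 - (x + z) + (y + z)) n / pochhammer (1 - (x + z)) (Suc n) / real (Suc n)"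
proof -
  have *: "(\<Prod>i=1..n. 1 + y / (real i - x)) * (\<Prod>i=1..n. 1 / (1 - z / (real i - x)))
      = pochhammer (1 - (x + z) + (y + z)) n / pochhammer (1 - (x + z)) n"
  proof (induction n)
    case (Suc n)
    have d: "real (Suc n) - x > 0" "real (Suc n) - x - z > 0" using assms by auto
    then have q: "(1 + y / (real (Suc n) - x)) * (1 / (1 - z / (real (Suc n) - x)))
        = (real (Suc n) - x + y) / (real (Suc n) - x - z)"
      by (simp add: divide_simps)
    have "(\<Prod>i=1..Suc n. 1 + y / (real i - x)) * (\<Prod>i=1..Suc n. 1 / (1 - z / (real i - x)))
      = (\<Prod>i=1..n. 1 + y / (real i - x)) * (\<Prod>i=1..n. 1 / (1 - z / (real i - x)))
        * ((1 + y / (real (Suc n) - x)) * (1 / (1 - z / (real (Suc n) - x))))"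
      by (simp add: mult.assoc mult.left_commute)
    also have "\<dots> = pochhammer (1 - (x + z) + (y + z)) n / pochhammer (1 - (x + z)) n
        * ((real (Suc n) - x + y) / (real (Suc n) - x - z))"
      unfolding Suc q ..
    also have "\<dots> = pochhammer (1 - (x + z) + (y + z)) (Suc n) / pochhammer (1 - (x + z)) (Suc n)"
      by (simp add: pochhammer_Suc) (simp add: algebra_simps)
    finally show ?case .
  qed simp
  have d: "real (Suc n) - x > 0" "real (Suc n) - x - z > 0" using assms by auto
  then have e: "1 / (1 - z / (real (Suc n) - x)) / (real (Suc n) * (real (Suc n) - x)) = 1 / (real (Suc n) - x - z) / real (Suc n)"
    by (simp add: divide_simps)
  have "(\<Prod>i=1..n. 1 + y / (real i - x)) * (\<Prod>i=1..Suc n. 1 / (1 - z / (real i - x))) / (real (Suc n) * (real (Suc n) - x))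
    = ((\<Prod>i=1..n. 1 + y / (real i - x)) * (\<Prod>i=1..n. 1 / (1 - z / (real i - x))))
      * (1 / (1 - z / (real (Suc n) - x)) / (real (Suc n) * (real (Suc n) - x)))"
    by simp
  also have "\<dots> = pochhammer (1 - (x + z) + (y + z)) n / pochhammer (1 - (x + z)) n * (1 / (real (Suc n) - x - z) / real (Suc n))"
    unfolding * e ..
  also have "\<dots> = pochhammer (1 - (x + z) + (y + z)) n / pochhammer (1 - (x + z)) (Suc n) / real (Suc n)"
    by (simp add: pochhammer_Suc algebra_simps)
  finally show ?thesis .
qed

text \<open>
  A datum \<open>(n, (as, fs), (bs, es), e)\<close> encodes the column \<open>as @ [n + 1]\<close> with exponents
  \<open>map Suc fs @ [e + 2]\<close> and the row \<open>bs\<close> with exponents \<open>map Suc es\<close>, so that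
  all the exponent variables range freely over the naturals.
\<close>

definition filling_data :: "nat \<Rightarrow> ((nat list \<times> nat list) \<times> (nat list \<times> nat list) \<times> nat) set" where
  "filling_data n = strict_pairs n \<times> weak_pairs (Suc n) \<times> UNIV"

text \<open>For the corner, t = 1 / (n + 1) supplies one more power, so its weight is x^e / (n +
  1)^(e + 2) and its exponent is at least 2.\<close>

definition data_weight :: "real \<Rightarrow> real \<Rightarrow> real \<Rightarrow> nat \<times> (nat list \<times> nat list) \<times> (nat list \<times> nat list) \<times> nat \<Rightarrow> real" where
  "data_weight x y z = (\<lambda>(n, u, v, e). list_weight y x u * (list_weight z x v * weight (1 / real (Suc n)) x (Suc n) e))"

text \<open>For fixed n the sums over column, row and corner exponent are independent; their product
  is the summand of the connected sum identity with p = x + z and c = y + z.\<close>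

lemma has_sum_data_weight:
  assumes xyz: "0 < x" "x \<le> 1/4" "0 < y" "y \<le> 1/4" "0 < z" "z \<le> 1/4"
    and V: "((\<lambda>m. 1 / ((real (Suc m) - (x + z)) * (real (Suc m) - (y + z)))) has_sum V) UNIV"
  shows "(data_weight x y z has_sum V) (SIGMA n:UNIV. filling_data n)"
proof (rule has_sum_Sigma_nonneg)
  show "((\<lambda>n. pochhammer (1 - (x + z) + (y + z)) n / pochhammer (1 - (x + z)) (Suc n) / real (Suc n)) has_sum V) UNIV"
    using xyz V by (intro connected_sum_identity) auto
  show "0 \<le> data_weight x y z (n, w)" for n w
    using xyz list_weight_nonneg[of y x "fst w"] list_weight_nonneg[of z x "fst (snd w)"]
      weight_nonneg[of "1 / real (Suc n)" x "Suc n" "snd (snd w)"]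
    unfolding data_weight_def by (cases w) (simp add: mult_nonneg_nonneg del: of_nat_Suc)
  show "((\<lambda>w. data_weight x y z (n, w)) has_sum
      pochhammer (1 - (x + z) + (y + z)) n / pochhammer (1 - (x + z)) (Suc n) / real (Suc n)) (filling_data n)" for n
  proof -
    have "((\<lambda>(u, w). list_weight y x u * (case w of (v, e) \<Rightarrow> list_weight z x v * weight (1 / real (Suc n)) x (Suc n) e))
      has_sum (\<Prod>i=1..n. 1 + y / (real i - x)) * ((\<Prod>i=1..Suc n. 1 / (1 - z / (real i - x))) *
        (1 / real (Suc n) / (real (Suc n) - x)))) (strict_pairs n \<times> weak_pairs (Suc n) \<times> UNIV)"
      using xyz list_weight_nonneg[of y x] list_weight_nonneg[of z x]
      by (intro has_sum_times_nonneg has_sum_strict_pairs has_sum_weak_pairs has_sum_weight)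
        (auto intro!: weight_nonneg mult_nonneg_nonneg prod_list_nonneg simp del: of_nat_Suc)
    moreover have "(\<Prod>i=1..n. 1 + y / (real i - x)) * ((\<Prod>i=1..Suc n. 1 / (1 - z / (real i - x))) *
        (1 / real (Suc n) / (real (Suc n) - x)))
        = pochhammer (1 - (x + z) + (y + z)) n / pochhammer (1 - (x + z)) (Suc n) / real (Suc n)"
      using prod_eq_pochhammer_ratio[of x z y n] xyz by (simp add: mult.assoc del: of_nat_Suc prod.cl_ivl_Suc)
    ultimately show ?thesis
      by (simp only: filling_data_def data_weight_def case_prod_unfold fst_conv snd_conv)
  qed
qed

section \<open>Bijection with anti-hook indices and fillings\<close>

text \<open>Here r = j + 1 and w = i + j + s + 2, so i is the total excess of the exponents over
  their least possible sum s + (r - 1) + 2.\<close>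

definition antihook_data :: "nat \<times> nat \<times> nat \<Rightarrow> ((nat list \<times> nat list) \<times> (nat list \<times> nat list)) set" where
  "antihook_data = (\<lambda>(i, j, s). admissible_indices s (Suc j) (i + j + s + 2) \<times> antihook_fillings s (Suc j))"

definition antihook_weight :: "real \<Rightarrow> real \<Rightarrow> real \<Rightarrow> (nat \<times> nat \<times> nat) \<times> ((nat list \<times> nat list) \<times> (nat list \<times> nat list)) \<Rightarrow> real" where
  "antihook_weight x y z = (\<lambda>((i, j, s), ((ls, ks), p)). antihook_term ls ks p * (x ^ i * y ^ j * z ^ s))"

definition to_antihook where
  "to_antihook = (\<lambda>(n, (as, fs), (bs, es), e).
     ((sum_list es + sum_list fs + e, length fs, length es),
      ((map Suc es, map Suc fs @ [e + 2]), (bs, as @ [Suc n]))))"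

definition from_antihook :: "(nat \<times> nat \<times> nat) \<times> ((nat list \<times> nat list) \<times> (nat list \<times> nat list)) \<Rightarrow>
    nat \<times> (nat list \<times> nat list) \<times> (nat list \<times> nat list) \<times> nat" where
  "from_antihook = (\<lambda>(_, ((ls, ks), (bs, as))).
     (last as - 1, (butlast as, map (\<lambda>k. k - 1) (butlast ks)), (bs, map (\<lambda>l. l - 1) ls), last ks - 2))"

lemma sum_list_map_Suc: "sum_list (map Suc es) = sum_list es + length es"
  by (induction es) auto

lemma map_Suc_pred: "\<forall>k\<in>set ks. 1 \<le> k \<Longrightarrow> map (Suc \<circ> (\<lambda>k. k - 1)) ks = ks"
  by (induction ks) auto

lemma sum_list_pred: "\<forall>k\<in>set ks. 1 \<le> k \<Longrightarrow> sum_list ks = sum_list (map (\<lambda>k. k - 1) ks) + length ks"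
  by (induction ks) auto

lemma to_antihook_weight:
  assumes "w \<in> (SIGMA n:UNIV. filling_data n)"
  shows "antihook_weight x y z (to_antihook w) = data_weight x y z w"
proof -
  obtain n as fs bs es e where w: "w = (n, (as, fs), (bs, es), e)" by (cases w) auto
  have len: "length as = length fs" "length bs = length es"
    using assms by (auto simp: w filling_data_def strict_pairs_def weak_pairs_def)
  \<comment> \<open>The corner, last in the column, is split off with its exponent e + 2.\<close>
  have "(\<Prod>i<Suc (length fs). real ((as @ [Suc n]) ! i) ^ ((map Suc fs @ [e + 2]) ! i))
      = (\<Prod>i<length fs. real (as ! i) ^ (map Suc fs ! i)) * real (Suc n) ^ (e + 2)"
    using len by (simp add: nth_append del: of_nat_Suc)
  moreover have "weight (1 / real (Suc n)) x (Suc n) e = x ^ e / real (Suc n) ^ (e + 2)"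
    by (simp add: weight_def)
  ultimately show ?thesis
    using len
    by (simp add: w to_antihook_def antihook_weight_def data_weight_def prod_list_weight antihook_term_def
        power_add mult_ac del: prod.lessThan_Suc of_nat_Suc)
qed

lemma to_antihook_in:
  assumes "w \<in> (SIGMA n:UNIV. filling_data n)"
  shows "to_antihook w \<in> (SIGMA t:UNIV. antihook_data t)" "from_antihook (to_antihook w) = w"
proof -
  obtain n as fs bs es e where w: "w = (n, (as, fs), (bs, es), e)" by (cases w) auto
  show "to_antihook w \<in> (SIGMA t:UNIV. antihook_data t)"
    using assms
    by (fastforce simp: w to_antihook_def antihook_data_def admissible_indices_def antihook_fillings_def
        filling_data_def strict_pairs_def weak_pairs_def strict_lists_def weak_lists_def sum_list_map_Suc
        sorted_wrt_append sorted_append subset_iff)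
  show "from_antihook (to_antihook w) = w"
    by (simp add: w to_antihook_def from_antihook_def o_def)
qed

text \<open>The truncated subtractions are exact because all entries and exponents are positive and
  the last column exponent is at least 2; i is recovered from the total weight.\<close>

lemma from_antihook_in:
  assumes "v \<in> (SIGMA t:UNIV. antihook_data t)"
  shows "from_antihook v \<in> (SIGMA n:UNIV. filling_data n)" "to_antihook (from_antihook v) = v"
proof -
  obtain i j s ls ks bs as where v: "v = ((i, j, s), ((ls, ks), (bs, as)))" by (cases v) auto
  have len: "length ls = s" "length ks = Suc j" "length bs = s" "length as = Suc j"
    and l: "\<forall>l\<in>set ls. 1 \<le> l" "\<forall>k\<in>set ks. 1 \<le> k" "2 \<le> last ks" "sum_list ls + sum_list ks = i + j + s + 2"
    and fill: "sorted_wrt (<) (0 # as)" "sorted_wrt (\<le>) (bs @ [last as])" "\<forall>b\<in>set bs. 0 < b"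
    using assms by (auto simp: v antihook_data_def admissible_indices_def antihook_fillings_def)
  obtain as' a where as: "as = as' @ [a]" using len by (metis append_butlast_last_id list.size(3) nat.distinct(1))
  obtain ks' k where ks: "ks = ks' @ [k]" using len by (metis append_butlast_last_id list.size(3) nat.distinct(1))
  show "from_antihook v \<in> (SIGMA n:UNIV. filling_data n)"
    using len fill
    by (fastforce simp: v as ks from_antihook_def filling_data_def strict_pairs_def weak_pairs_def
        strict_lists_def weak_lists_def sorted_wrt_append)
  show "to_antihook (from_antihook v) = v"
    using len l fill sum_list_pred[of ls] sum_list_pred[of ks']
    by (auto simp: v as ks from_antihook_def to_antihook_def map_Suc_pred[simplified])
qed

lemma has_sum_antihook_weight:
  "(data_weight x y z has_sum V) (SIGMA n:UNIV. filling_data n) \<longleftrightarrow>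
   (antihook_weight x y z has_sum V) (SIGMA t:UNIV. antihook_data t)"
  by (rule has_sum_reindex_bij_witness[where i = from_antihook and j = to_antihook])
    (simp_all only: to_antihook_in from_antihook_in to_antihook_weight)

section \<open>Convergence and the generating function of the anti-hook sums\<close>

text \<open>Convergence comes from the generating function at x = y = z = 1/4: restrict it to the
  fibre over \<open>t\<close> and divide by the nonzero monomial.\<close>

lemma summable_antihook_term:
  "(\<lambda>((ls, ks), p). antihook_term ls ks p) summable_on antihook_data t"
proof (cases t)
  case (fields i j s)
  have "antihook_weight (1/4) (1/4) (1/4) summable_on (SIGMA t:UNIV. antihook_data t)"
    using has_sum_data_weight[OF _ _ _ _ _ _ has_sum_zeta_generating_function(1), of "1/4" "1/4" "1/4"]
    by (auto simp: has_sum_antihook_weight dest: has_sum_imp_summable)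
  then have "(\<lambda>(t, u). antihook_weight (1/4) (1/4) (1/4) (t, u)) summable_on (SIGMA t:UNIV. antihook_data t)"
    by simp
  from summable_on_SigmaD1[OF this, of t]
  have "(\<lambda>u. (case u of ((ls, ks), p) \<Rightarrow> antihook_term ls ks p) * ((1/4) ^ i * (1/4) ^ j * (1/4) ^ s)) summable_on antihook_data t"
    by (simp add: fields antihook_weight_def case_prod_unfold)
  then show ?thesis
    by (subst (asm) summable_on_cmult_left') (auto simp: case_prod_unfold)
qed

lemma summable_antihook_fillings:
  assumes "(ls, ks) \<in> admissible_indices s (Suc j) (i + j + s + 2)"
  shows "antihook_term ls ks summable_on antihook_fillings s (Suc j)"
proof -
  have "(\<lambda>(u, p). (case u of (ls, ks) \<Rightarrow> antihook_term ls ks) p) summable_on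
      admissible_indices s (Suc j) (i + j + s + 2) \<times> antihook_fillings s (Suc j)"
    using summable_antihook_term[of "(i, j, s)"] by (simp add: antihook_data_def case_prod_unfold)
  from summable_on_SigmaD1[OF this assms] show ?thesis by simp
qed

text \<open>Joint summability lets the sum be taken filling by filling first; the outer sum is over
  the finite set of indices.\<close>

lemma has_sum_S_antihook:
  "((\<lambda>((ls, ks), p). antihook_term ls ks p) has_sum S_antihook (i + j + s + 2) s (Suc j)) (antihook_data (i, j, s))"
  (is "(?f has_sum _) _")
proof -
  let ?I = "admissible_indices s (Suc j) (i + j + s + 2)"
  let ?F = "antihook_fillings s (Suc j)"
  have "(?f has_sum infsum ?f (?I \<times> ?F)) (?I \<times> ?F)"
    using summable_antihook_term[of "(i, j, s)"] by (simp add: antihook_data_def)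
  moreover have "((\<lambda>p. ?f (u, p)) has_sum (case u of (ls, ks) \<Rightarrow> schur_mzv_antihook ls ks)) ?F" if "u \<in> ?I" for u
  proof (cases u)
    case (Pair ls ks)
    then have "length ls = s" "length ks = Suc j" using that by (auto simp: admissible_indices_def)
    then show ?thesis
      using summable_antihook_fillings that Pair by (auto simp: schur_mzv_antihook_def)
  qed
  ultimately have "((\<lambda>(ls, ks). schur_mzv_antihook ls ks) has_sum infsum ?f (?I \<times> ?F)) ?I"
    by (rule has_sum_SigmaD)
  then have "infsum ?f (?I \<times> ?F) = S_antihook (i + j + s + 2) s (Suc j)"
    unfolding S_antihook_def using finite_admissible_indices by (simp add: has_sum_finite_iff)
  then show ?thesis
    using \<open>(?f has_sum _) (?I \<times> ?F)\<close> by (simp add: antihook_data_def)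
qed

text \<open>After the bijection the family is grouped by (i, j, s), and the monomial is constant on
  each group.\<close>

lemma has_sum_S_antihook_generating_function:
  assumes "(data_weight x y z has_sum V) (SIGMA n:UNIV. filling_data n)"
  shows "((\<lambda>(i, j, s). S_antihook (i + j + s + 2) s (Suc j) * (x ^ i * y ^ j * z ^ s)) has_sum V) UNIV"
proof (rule has_sum_SigmaD)
  show "(antihook_weight x y z has_sum V) (SIGMA t:UNIV. antihook_data t)"
    using assms by (simp only: has_sum_antihook_weight)
  show "((\<lambda>u. antihook_weight x y z (t, u)) has_sum
      (case t of (i, j, s) \<Rightarrow> S_antihook (i + j + s + 2) s (Suc j) * (x ^ i * y ^ j * z ^ s))) (antihook_data t)" for t
    using has_sum_cmult_left[OF has_sum_S_antihook]
    by (cases t) (simp add: antihook_weight_def case_prod_unfold)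
qed

section \<open>Comparison of coefficients in three variables\<close>

lemma powser3_unique:
  fixes f g :: "nat \<times> nat \<times> nat \<Rightarrow> real" and \<epsilon> :: real
  assumes e: "0 < \<epsilon>"
    and fg: "\<And>x y z. \<lbrakk>0 < x; x \<le> \<epsilon>; 0 < y; y \<le> \<epsilon>; 0 < z; z \<le> \<epsilon>\<rbrakk> \<Longrightarrow>
      \<exists>V. ((\<lambda>(i, j, s). f (i, j, s) * (x ^ i * y ^ j * z ^ s)) has_sum V) UNIV \<and>
          ((\<lambda>(i, j, s). g (i, j, s) * (x ^ i * y ^ j * z ^ s)) has_sum V) UNIV"
  shows "f (i, j, s) = g (i, j, s)"
proof (rule powser_coeff_unique[OF e])
  fix z assume z: "0 < z" "z \<le> \<epsilon>"
  have "\<exists>W. ((\<lambda>s. f (i, j, s) * z ^ s) has_sum W) UNIV \<and> ((\<lambda>s. g (i, j, s) * z ^ s) has_sum W) UNIV"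
  proof -
    have "\<exists>V. ((\<lambda>(j, s). (case (j, s) of (j, s) \<Rightarrow> f (i, j, s) * z ^ s) * y ^ j) has_sum V) UNIV \<and>
          ((\<lambda>(j, s). (case (j, s) of (j, s) \<Rightarrow> g (i, j, s) * z ^ s) * y ^ j) has_sum V) UNIV"
      if y: "0 < y" "y \<le> \<epsilon>" for y
      \<comment> \<open>For fixed y and z this removes x and leaves a family in (j, s); the next
        application removes y.\<close>
      using powser_fibre_unique[OF e, of "\<lambda>(i, j, s). f (i, j, s) * z ^ s * y ^ j" "\<lambda>(i, j, s). g (i, j, s) * z ^ s * y ^ j" i]
        fg[OF _ _ y z] by (simp add: case_prod_unfold ac_simps)
    from powser_fibre_unique[OF e this, of j] show ?thesis by simp
  qed
  then show "\<exists>V. (\<lambda>s. f (i, j, s) * z ^ s) sums V \<and> (\<lambda>s. g (i, j, s) * z ^ s) sums V"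
    using has_sum_imp_sums by blast
qed

theorem theorem3p8:
  fixes r s w :: nat
  assumes "1 \<le> r" and "s + r + 1 \<le> w"
  shows "(\<forall>(ls, ks)\<in>admissible_indices s r w.
            antihook_term ls ks summable_on antihook_fillings s r) \<and>
         S_antihook w s r = real ((w - 1) choose s) * zeta w"
proof -
  obtain j where r: "r = Suc j" using assms(1) by (cases r) auto
  \<comment> \<open>The lower bound on w makes w - r - s - 1 a natural number.\<close>
  obtain i where w: "w = i + j + s + 2"
    using assms(2) by (auto simp: r dest!: le_Suc_ex)
  have "(case (i, j, s) of (i, j, s) \<Rightarrow> S_antihook (i + j + s + 2) s (Suc j))
      = (case (i, j, s) of (i, j, s) \<Rightarrow> real ((i + j + s + 1) choose s) * zeta (i + j + s + 2))"
  proof (rule powser3_unique)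
    fix x y z :: real
    \<comment> \<open>The bound 1/4 keeps x + z and y + z at most 1/2, as the connected sum
      requires.\<close>
    assume xyz: "0 < x" "x \<le> 1/4" "0 < y" "y \<le> 1/4" "0 < z" "z \<le> 1/4"
    show "\<exists>V. ((\<lambda>(i, j, s). (case (i, j, s) of (i, j, s) \<Rightarrow> S_antihook (i + j + s + 2) s (Suc j))
            * (x ^ i * y ^ j * z ^ s)) has_sum V) UNIV \<and>
        ((\<lambda>(i, j, s). (case (i, j, s) of (i, j, s) \<Rightarrow> real ((i + j + s + 1) choose s) * zeta (i + j + s + 2))
            * (x ^ i * y ^ j * z ^ s)) has_sum V) UNIV"
      unfolding prod.case
      using has_sum_S_antihook_generating_function[OF has_sum_data_weight[OF xyz has_sum_zeta_generating_function(1)[OF xyz]]]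
        has_sum_zeta_generating_function(2)[OF xyz]
      by (intro exI conjI)
  qed simp
  then have "S_antihook w s r = real ((w - 1) choose s) * zeta w"
    by (simp add: r w)
  then show ?thesis
    using summable_antihook_fillings by (auto simp: r w)
qed

end
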